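(* For any integers $k \geq 2$, $\alpha,\beta \geq 0$ and $0 \leq m \leq \min(\alpha,\beta)$, $${_m}C_{k,(\alpha,\beta)}(t) = C_{k,(\alpha-m,0)}(t) \, C_k(t)^{\beta-m}.$$
   Context: For an integer $k\ge 2$ and integers $\alpha,\beta, n\ge 0$, let $\mathcal{D}^k_{n,(\alpha,\beta)}$ be the set of integer lattice paths from $(0,\alpha)$ to $(kn+\beta-\alpha,\beta)$ using steps $U=(1,1)$ and $D=(1,1-k)$ that stay weakly above the line $y=0$ (such paths have exactly $n$ steps $D$; the empty path is included when $n=0$, $\alpha=\beta$), with $C^k_{n,(\alpha,\beta)}=|\mathcal{D}^k_{n,(\alpha,\beta)}|$ and $C_{k,(\alpha,\beta)}(t)=\sum_{n\ge0}C^k_{n,(\alpha,\beta)}t^n$. For $m\ge 0$, ${_m}C^k_{n,(\alpha,\beta)}$ is the number of paths in $\mathcal{D}^k_{n,(\alpha,\beta)}$ whose minimum $y$-coordinate equals $m$, and ${_m}C_{k,(\alpha,\beta)}(t)=\sum_{n\ge0}{_m}C^k_{n,(\alpha,\beta)}t^n$. $C_k(t)=\sum_{n\ge0} \frac{1}{kn+1}\binom{kn+1}{n} t^n$ is the $k$-Catalan generating function. *)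

theory Defs
  imports "HOL-Computational_Algebra.Formal_Power_Series" "HOL-Library.Product_Plus"
begin

(* A lattice path is its starting point together with its list of step vectors. *)

definition lattice_steps :: "nat \<Rightarrow> (int \<times> int) set" where
  "lattice_steps k = {(1, 1), (1, 1 - int k)}"

fun path_vertices :: "int \<times> int \<Rightarrow> (int \<times> int) list \<Rightarrow> (int \<times> int) list" where
  "path_vertices p [] = [p]"
| "path_vertices p (s # ss) = p # path_vertices (p + s) ss"

(* The endpoint abscissa is an integer expression that may be negative, in which
   case there is no path. A path lies on or above y = 0 iff its vertices do. *)
definition lattice_paths :: "nat \<Rightarrow> nat \<Rightarrow> nat \<Rightarrow> nat \<Rightarrow> (int \<times> int) list set" where
  "lattice_paths k n \<alpha> \<beta> =
     {ss. set ss \<subseteq> lattice_steps k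
        \<and> last (path_vertices (0, int \<alpha>) ss) = (int k * int n + int \<beta> - int \<alpha>, int \<beta>)
        \<and> (\<forall>(x, y) \<in> set (path_vertices (0, int \<alpha>) ss). y \<ge> 0)}"

definition path_min :: "nat \<Rightarrow> (int \<times> int) list \<Rightarrow> int" where
  "path_min \<alpha> ss = Min (snd ` set (path_vertices (0, int \<alpha>) ss))"

definition path_count :: "nat \<Rightarrow> nat \<Rightarrow> nat \<Rightarrow> nat \<Rightarrow> nat" where
  "path_count k n \<alpha> \<beta> = card (lattice_paths k n \<alpha> \<beta>)"

definition path_count_min :: "nat \<Rightarrow> nat \<Rightarrow> nat \<Rightarrow> nat \<Rightarrow> nat \<Rightarrow> nat" where
  "path_count_min m k n \<alpha> \<beta> = card {ss \<in> lattice_paths k n \<alpha> \<beta>. path_min \<alpha> ss = int m}"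

definition path_gf :: "nat \<Rightarrow> nat \<Rightarrow> nat \<Rightarrow> rat fps" where
  "path_gf k \<alpha> \<beta> = Abs_fps (\<lambda>n. of_nat (path_count k n \<alpha> \<beta>))"

definition path_gf_min :: "nat \<Rightarrow> nat \<Rightarrow> nat \<Rightarrow> nat \<Rightarrow> rat fps" where
  "path_gf_min m k \<alpha> \<beta> = Abs_fps (\<lambda>n. of_nat (path_count_min m k n \<alpha> \<beta>))"

definition k_catalan_gf :: "nat \<Rightarrow> rat fps" where
  "k_catalan_gf k =
     Abs_fps (\<lambda>n. 1 / of_nat (k * n + 1) * of_nat ((k * n + 1) choose n))"

lemma fst_last_path_vertices:
  assumes "set ss \<subseteq> lattice_steps k"
  shows "fst (last (path_vertices p ss)) = fst p + int (length ss)"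
proof -
  have ne: "path_vertices q ts \<noteq> []" for q ts by (cases ts) auto
  show ?thesis using assms
    by (induction ss arbitrary: p) (auto simp: ne lattice_steps_def)
qed

(* Hence the cardinalities above are genuine counts. *)
lemma finite_lattice_paths: "finite (lattice_paths k n \<alpha> \<beta>)"
proof (rule finite_subset)
  show "lattice_paths k n \<alpha> \<beta> \<subseteq>
      {ss. set ss \<subseteq> lattice_steps k \<and> length ss = nat (int k * int n + int \<beta> - int \<alpha>)}"
    using fst_last_path_vertices[of _ k "(0, int \<alpha>)"]
    by (force simp: lattice_paths_def)
  show "finite {ss. set ss \<subseteq> lattice_steps k \<and> length ss = nat (int k * int n + int \<beta> - int \<alpha>)}"
    by (rule finite_lists_length_eq) (simp add: lattice_steps_def)
qed

end

theory Submission
  imports Defs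
begin

text \<open>
  Cutting off the last step shows that the generating functions \<open>E a b\<close> of paths from height \<open>a\<close>
  to height \<open>b\<close> satisfy \<open>E a b = [a = b] + E a (b - 1) + t E a (b + k - 1)\<close>, where \<open>E a (-1) = 0\<close>.
  A path with minimum \<open>m\<close> stays weakly above \<open>m\<close> but not above \<open>m + 1\<close>, so after lowering by \<open>m\<close> it is
  counted by the difference \<open>E a b - E (a - 1) (b - 1)\<close>. In this difference the
  inhomogeneous terms cancel, so it satisfies \<open>H (b + 1) = H b + t H (b + k)\<close>. This recurrence
  determines \<open>H\<close> linearly from \<open>H 0\<close>; hence \<open>H b = H 0 * R b\<close>, where \<open>R b\<close> is the solution with
  \<open>R 0 = 1\<close>. Applied to the shifts of \<open>R\<close> itself this gives \<open>R b = R 1 ^ b\<close>, and \<open>R 1\<close> is the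
  \<open>k\<close>-Catalan series because \<open>R b\<close> has the Rothe numbers
  \<open>b / (k n + b) * ((k n + b) choose n)\<close> as coefficients.
\<close>

section \<open>The linear recurrence and its solution by Rothe numbers\<close>

text \<open>By linearity the difference \<open>G\<close> of the two sides obeys the recurrence with
  \<open>G 0 = 0\<close>. Coefficient \<open>n\<close> of \<open>G (Suc b)\<close> involves only
  coefficient \<open>n\<close> of \<open>G b\<close> and, because of the factor
  \<open>fps_X\<close>, coefficient \<open>n - 1\<close> of \<open>G (b + k)\<close>, so induction
  on \<open>n\<close> with an inner induction on \<open>b\<close> kills all of them.\<close>

lemma catalan_recurrence_unique:
  fixes H R :: "nat \<Rightarrow> 'a::comm_ring_1 fps"
  assumes H: "\<And>b. H (Suc b) = H b + fps_X * H (b + k)"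
    and R: "\<And>b. R (Suc b) = R b + fps_X * R (b + k)" and R0: "R 0 = 1"
  shows "H b = H 0 * R b"
proof -
  define G where "G b = H b - H 0 * R b" for b
  have G: "G (Suc b) = G b + fps_X * G (b + k)" for b
    by (simp add: G_def H R algebra_simps)
  have G0: "G 0 = 0"
    by (simp add: G_def R0)
  have "fps_nth (G b) n = 0" for b n
  proof (induction n arbitrary: b)
    case 0
    show ?case by (induction b) (simp_all add: G0 G)
  next
    case (Suc n)
    show ?case by (induction b) (simp_all add: G0 G Suc)
  qed
  then have "G b = 0" by (simp add: fps_eq_iff)
  then show ?thesis by (simp add: G_def)
qed

text \<open>At \<open>b = n = 0\<close> the quotient would be \<open>0 / 0 = 0\<close>, hence the case distinction.\<close>

definition rothe_gf :: "nat \<Rightarrow> nat \<Rightarrow> rat fps" where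
  "rothe_gf k b = Abs_fps (\<lambda>n. if n = 0 then 1
     else of_nat b / of_nat (k * n + b) * of_nat ((k * n + b) choose n))"

lemma rothe_gf_0: "rothe_gf k 0 = 1"
  by (simp add: rothe_gf_def fps_eq_iff)

lemma rothe_gf_1: "rothe_gf k 1 = k_catalan_gf k"
  by (simp add: rothe_gf_def k_catalan_gf_def fps_eq_iff)

text \<open>In coefficient \<open>j + 1\<close> all three binomials are rational multiples of
  \<open>N choose j\<close>, where \<open>N = k * (j + 1) + b\<close>. This leaves
  \<open>b * (N - j) + (b + k) * (j + 1) = (b + 1) * N\<close>, which is the definition of
  \<open>N\<close> in disguise.\<close>

lemma rothe_gf_Suc:
  assumes "k \<ge> 1"
  shows "rothe_gf k (Suc b) = rothe_gf k b + fps_X * rothe_gf k (b + k)"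
proof (rule fps_ext)
  fix n
  show "fps_nth (rothe_gf k (Suc b)) n = fps_nth (rothe_gf k b + fps_X * rothe_gf k (b + k)) n"
  proof (cases n)
    case 0
    then show ?thesis by (simp add: rothe_gf_def)
  next
    case (Suc j)
    define N where "N = k * Suc j + b"
    have N: "N > 0" using assms by (simp add: N_def)
    have Nr: "(of_nat N :: rat) = of_nat k * (of_nat j + 1) + of_nat b"
      by (simp add: N_def algebra_simps)
    have pos: "(of_nat N :: rat) > 0" "(of_nat j + 1 :: rat) > 0" using N by auto
    define c :: rat where "c = of_nat (N choose j)"
    have "Suc j * (Suc N choose Suc j) = Suc N * (N choose j)"
      by (rule Suc_times_binomial)
    then have "of_nat (Suc j * (Suc N choose Suc j)) = (of_nat (Suc N * (N choose j)) :: rat)"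
      by (rule arg_cong)
    then have c1: "of_nat (Suc N choose Suc j) = (of_nat N + 1) * c / (of_nat j + 1)"
      using pos by (simp add: c_def field_simps del: binomial_Suc_Suc)
    have c2: "of_nat (N choose Suc j) = (of_nat N - of_nat j) * c / (of_nat j + 1)"
    proof -
      have "of_nat (Suc N choose Suc j) = c + of_nat (N choose Suc j)"
        by (simp add: c_def)
      with c1 show ?thesis using pos by (simp add: field_simps)
    qed
    have L: "fps_nth (rothe_gf k (Suc b)) n
        = (of_nat b + 1) / (of_nat N + 1) * of_nat (Suc N choose Suc j)"
      by (simp add: rothe_gf_def Suc N_def add_ac del: binomial_Suc_Suc)
    have R1: "fps_nth (rothe_gf k b) n = of_nat b / of_nat N * of_nat (N choose Suc j)"
      by (simp add: rothe_gf_def Suc N_def add_ac del: binomial_Suc_Suc)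
    have R2: "fps_nth (rothe_gf k (b + k)) j = (of_nat b + of_nat k) / of_nat N * c"
    proof (cases j)
      \<comment> \<open>The separate constant coefficient 1 agrees with the general formula, as here
        \<open>N = b + k\<close>.\<close>
      case 0
      then have "(of_nat b + of_nat k :: rat) = of_nat N" by (simp add: N_def)
      with 0 show ?thesis using pos by (simp add: rothe_gf_def c_def)
    next
      case (Suc i)
      have "k * j + (b + k) = N" by (simp add: N_def)
      then show ?thesis using Suc by (simp add: rothe_gf_def c_def add_ac)
    qed
    have "of_nat b * (of_nat N - of_nat j) + (of_nat b + of_nat k) * (of_nat j + 1)
        = (of_nat b + 1) * (of_nat N :: rat)"
      by (simp add: Nr algebra_simps)
    then have "(of_nat b + 1) * c / (of_nat j + 1)
        = (of_nat b * (of_nat N - of_nat j) + (of_nat b + of_nat k) * (of_nat j + 1)) * c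
            / (of_nat N * (of_nat j + 1))"
      using pos by simp
    also have "\<dots> = of_nat b / of_nat N * ((of_nat N - of_nat j) * c / (of_nat j + 1))
        + (of_nat b + of_nat k) / of_nat N * c"
      using pos by (simp add: divide_simps) (simp add: algebra_simps)
    finally have "fps_nth (rothe_gf k (Suc b)) n
        = fps_nth (rothe_gf k b) n + fps_nth (rothe_gf k (b + k)) j"
      using pos by (simp add: L R1 R2 c1 c2 del: binomial_Suc_Suc)
    then show ?thesis by (simp add: Suc)
  qed
qed

lemma rothe_gf_power:
  assumes "k \<ge> 1"
  shows "rothe_gf k b = k_catalan_gf k ^ b"
proof (induction b)
  case 0
  show ?case by (simp add: rothe_gf_0)
next
  case (Suc b)
  have "rothe_gf k (Suc b) = rothe_gf k (Suc 0) * rothe_gf k b"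
    using catalan_recurrence_unique[of "\<lambda>b. rothe_gf k (Suc b)" k "rothe_gf k" b]
      rothe_gf_Suc[OF assms] by (simp add: rothe_gf_0)
  with Suc show ?case by (simp add: rothe_gf_1[simplified])
qed

section \<open>Removing the last step of a path\<close>

lemma path_vertices_nonempty [simp]: "path_vertices p ss \<noteq> []"
  by (cases ss) auto

lemma path_vertices_snoc:
  "path_vertices p (ss @ [s]) = path_vertices p ss @ [last (path_vertices p ss) + s]"
  by (induction ss arbitrary: p) auto

lemma path_vertices_translate:
  "path_vertices (p + q) ss = map (\<lambda>v. v + q) (path_vertices p ss)"
proof (induction ss arbitrary: p)
  case (Cons s ss)
  have "path_vertices (p + q + s) ss = path_vertices (p + s + q) ss" by (simp add: add_ac)
  with Cons show ?case by simp
qed simp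

text \<open>The witness \<open>d\<close> is the number of down steps; its being a natural number
  later excludes a final down step when \<open>n = 0\<close>.\<close>

lemma snd_last_path_vertices:
  assumes "set ss \<subseteq> lattice_steps k"
  shows "\<exists>d::nat. snd (last (path_vertices p ss)) = snd p + int (length ss) - int k * int d"
  using assms
proof (induction ss arbitrary: p)
  case Nil
  show ?case by (auto intro!: exI[of _ 0])
next
  case (Cons s ss)
  obtain d where d: "snd (last (path_vertices (p + s) ss))
      = snd (p + s) + int (length ss) - int k * int d"
    using Cons.IH[of "p + s"] Cons.prems by auto
  consider "s = (1, 1)" | "s = (1, 1 - int k)"
    using Cons.prems by (auto simp: lattice_steps_def)
  then show ?case
  proof cases
    case 1
    with d show ?thesis by (auto intro!: exI[of _ d])
  next
    case 2
    with d show ?thesis by (auto intro!: exI[of _ "Suc d"] simp: algebra_simps)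
  qed
qed

lemma Nil_in_lattice_paths:
  assumes "k \<ge> 1"
  shows "[] \<in> lattice_paths k n a b \<longleftrightarrow> n = 0 \<and> a = b"
  using assms by (auto simp: lattice_paths_def)

lemma snoc_up_in_lattice_paths:
  "ss @ [(1, 1)] \<in> lattice_paths k n a b \<longleftrightarrow> b > 0 \<and> ss \<in> lattice_paths k n a (b - 1)"
proof -
  obtain x y where l: "last (path_vertices (0, int a) ss) = (x, y)" by fastforce
  \<comment> \<open>As a vertex, the point before the final up step has \<open>y\<close> \<ge> 0,
    hence \<open>b = y + 1 > 0\<close>.\<close>
  then have m: "(x, y) \<in> set (path_vertices (0, int a) ss)"
    by (metis last_in_set path_vertices_nonempty)
  show ?thesis
    using m by (auto simp: lattice_paths_def path_vertices_snoc l lattice_steps_def of_nat_diff)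
qed

lemma snoc_down_in_lattice_paths:
  assumes "k \<ge> 1"
  shows "ss @ [(1, 1 - int k)] \<in> lattice_paths k n a b
    \<longleftrightarrow> n > 0 \<and> ss \<in> lattice_paths k (n - 1) a (b + k - 1)"
proof -
  obtain x y where l: "last (path_vertices (0, int a) ss) = (x, y)" by fastforce
  \<comment> \<open>If \<open>n = 0\<close>, comparing both endpoint coordinates gives
    \<open>k * (d + 1) = 0\<close>, where \<open>d\<close> counts the down steps before the last
    step.\<close>
  have "n > 0" if S: "set ss \<subseteq> lattice_steps k"
    and x: "x + 1 = int k * int n + int b - int a" and y: "y + 1 - int k = int b"
  proof (rule ccontr)
    assume "\<not> n > 0"
    obtain d where "y = int a + int (length ss) - int k * int d"
      using snd_last_path_vertices[OF S, of "(0, int a)"] l by auto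
    moreover have "x = int (length ss)"
      using fst_last_path_vertices[OF S, of "(0, int a)"] l by simp
    ultimately have "int k * int d + int k = 0" using x y \<open>\<not> n > 0\<close> by simp
    then show False using assms by (simp add: add_nonneg_eq_0_iff)
  qed
  moreover have "int k * int (n - 1) = int k * int n - int k" if "n > 0"
    using that by (simp add: of_nat_diff algebra_simps)
  ultimately show ?thesis
    using assms
    by (auto simp: lattice_paths_def path_vertices_snoc l lattice_steps_def of_nat_diff)
qed

lemma lattice_paths_last_step:
  assumes "k \<ge> 1"
  shows "lattice_paths k n a b = (if n = 0 \<and> a = b then {[]} else {})
    \<union> (if b = 0 then {} else (\<lambda>ss. ss @ [(1, 1)]) ` lattice_paths k n a (b - 1))
    \<union> (if n = 0 then {} else
        (\<lambda>ss. ss @ [(1, 1 - int k)]) ` lattice_paths k (n - 1) a (b + k - 1))"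
    (is "_ = ?R")
proof (rule set_eqI)
  fix ss
  show "ss \<in> lattice_paths k n a b \<longleftrightarrow> ss \<in> ?R"
  proof (cases ss rule: rev_cases)
    case Nil
    then show ?thesis using Nil_in_lattice_paths[OF assms] by auto
  next
    case (snoc ts s)
    have "s \<in> lattice_steps k" if "ss \<in> lattice_paths k n a b"
      using that by (auto simp: snoc lattice_paths_def)
    then consider "s = (1, 1)" | "s = (1, 1 - int k)" | "ss \<notin> lattice_paths k n a b"
        "s \<noteq> (1, 1)" "s \<noteq> (1, 1 - int k)"
      by (auto simp: lattice_steps_def)
    then show ?thesis
      using assms
      by cases (auto simp: snoc snoc_up_in_lattice_paths snoc_down_in_lattice_paths)
  qed
qed

lemma path_count_last_step:
  assumes "k \<ge> 1"
  shows "path_count k n a b = (if n = 0 \<and> a = b then 1 else 0)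
    + (if b = 0 then 0 else path_count k n a (b - 1))
    + (if n = 0 then 0 else path_count k (n - 1) a (b + k - 1))"
proof -
  have c: "card ((\<lambda>ss. ss @ [s]) ` A) = card A" for s :: "int \<times> int" and A
    by (rule card_image) (simp add: inj_on_def)
  show ?thesis
    unfolding path_count_def lattice_paths_last_step[OF assms, of n a b]
    using assms
    by (subst card_Un_disjoint; (subst card_Un_disjoint)?)
      (auto simp: c finite_lattice_paths)
qed

lemma path_gf_last_step:
  assumes "k \<ge> 1"
  shows "path_gf k a b = (if a = b then 1 else 0)
    + (if b = 0 then 0 else path_gf k a (b - 1)) + fps_X * path_gf k a (b + k - 1)"
  by (rule fps_ext) (simp add: path_gf_def path_count_last_step[OF assms, of _ a b])

section \<open>Paths with prescribed minimum\<close>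

lemma lattice_paths_lower:
  assumes "j \<le> a" "j \<le> b"
  shows "{ss \<in> lattice_paths k n a b. \<forall>v \<in> set (path_vertices (0, int a) ss). int j \<le> snd v}
    = lattice_paths k n (a - j) (b - j)"
proof -
  have *: "path_vertices (0, int a) ss
      = map (\<lambda>v. v + (0, int j)) (path_vertices (0, int (a - j)) ss)" for ss
    using path_vertices_translate[of "(0, int (a - j))" "(0, int j)" ss] assms
    by (simp add: of_nat_diff)
  have **: "v + (0, int j) = (x, int b) \<longleftrightarrow> v = (x, int (b - j))" for v and x :: int
    using assms by (cases v) (auto simp: of_nat_diff)
  \<comment> \<open>The final abscissa depends on the two heights only through their difference, so
    lowering keeps \<open>n\<close>.\<close>
  have "int b - int a = int (b - j) - int (a - j)" using assms by (simp add: of_nat_diff)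
  then show ?thesis
    unfolding lattice_paths_def * add_diff_eq[symmetric]
    by (auto simp: last_map ** split_beta)
qed

text \<open>The additive form avoids truncated subtraction. If \<open>a = m\<close> or
  \<open>b = m\<close>, an endpoint has height \<open>m\<close>, so no path stays above
  \<open>m + 1\<close>.\<close>

lemma path_count_min_eq:
  assumes "m \<le> a" "m \<le> b"
  shows "path_count_min m k n a b
      + (if a = m \<or> b = m then 0 else path_count k n (a - Suc m) (b - Suc m))
    = path_count k n (a - m) (b - m)"
proof -
  define L where "L j = {ss \<in> lattice_paths k n a b.
      \<forall>v \<in> set (path_vertices (0, int a) ss). int j \<le> snd v}" for j
  have L: "L j = lattice_paths k n (a - j) (b - j)" if "j \<le> a" "j \<le> b" for j
    using lattice_paths_lower[OF that] by (simp add: L_def)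
  have L_Suc: "card (L (Suc m))
      = (if a = m \<or> b = m then 0 else path_count k n (a - Suc m) (b - Suc m))"
  proof (cases "a = m \<or> b = m")
    case True
    have "(0, int a) \<in> set (path_vertices (0, int a) ss)" for ss by (cases ss) auto
    moreover have "(int k * int n + int b - int a, int b) \<in> set (path_vertices (0, int a) ss)"
      if "ss \<in> lattice_paths k n a b" for ss
    proof -
      have "last (path_vertices (0, int a) ss) \<in> set (path_vertices (0, int a) ss)"
        by (rule last_in_set) simp
      with that show ?thesis by (simp add: lattice_paths_def)
    qed
    ultimately have "L (Suc m) = {}" using True by (fastforce simp: L_def)
    with True show ?thesis by simp
  next
    case False
    then show ?thesis using assms by (simp add: L path_count_def)
  qed
  have min_iff: "path_min a ss = int m \<longleftrightarrow> (\<forall>v \<in> set (path_vertices (0, int a) ss). int m \<le> snd v)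
      \<and> \<not> (\<forall>v \<in> set (path_vertices (0, int a) ss). int (Suc m) \<le> snd v)" for ss
  proof -
    have "path_min a ss = int m \<longleftrightarrow> int m \<le> path_min a ss \<and> \<not> int (Suc m) \<le> path_min a ss"
      by auto
    then show ?thesis by (simp add: path_min_def del: of_nat_Suc)
  qed
  have fin: "finite (L j)" for j
    using finite_lattice_paths[of k n a b] by (simp add: L_def)
  have sub: "L (Suc m) \<subseteq> L m" by (force simp: L_def)
  have "{ss \<in> lattice_paths k n a b. path_min a ss = int m} = L m - L (Suc m)"
    unfolding min_iff L_def by blast
  then have "path_count_min m k n a b + card (L (Suc m)) = card (L m)"
    using card_Diff_subset[OF fin sub] card_mono[OF fin sub] by (simp add: path_count_min_def)
  then show ?thesis using L_Suc L[OF assms] by (simp add: path_count_def)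
qed

theorem theorem3p2:
  fixes k \<alpha> \<beta> m :: nat
  assumes "k \<ge> 2" and "m \<le> min \<alpha> \<beta>"
  shows "path_gf_min m k \<alpha> \<beta> = path_gf k (\<alpha> - m) 0 * k_catalan_gf k ^ (\<beta> - m)"
proof -
  have k: "k \<ge> 1" using assms by simp
  define a where "a = \<alpha> - m"
  define H where "H b = path_gf k a b - (if a = 0 \<or> b = 0 then 0 else path_gf k (a - 1) (b - 1))"
    for b
  \<comment> \<open>For \<open>a > 0\<close> the terms for \<open>a = Suc b\<close> and
    \<open>a - 1 = b\<close> cancel; for \<open>a = 0\<close> neither occurs.\<close>
  have "H (Suc b) = H b + fps_X * H (b + k)" for b
    using path_gf_last_step[OF k, of a "Suc b"] path_gf_last_step[OF k, of "a - 1" b] k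
    by (cases a) (auto simp: H_def algebra_simps)
  then have "H (\<beta> - m) = H 0 * rothe_gf k (\<beta> - m)"
    by (rule catalan_recurrence_unique) (simp_all add: rothe_gf_Suc[OF k] rothe_gf_0)
  moreover have "path_gf_min m k \<alpha> \<beta> = H (\<beta> - m)"
  proof (rule fps_ext)
    fix n
    have "of_nat (path_count_min m k n \<alpha> \<beta>
          + (if \<alpha> = m \<or> \<beta> = m then 0 else path_count k n (\<alpha> - Suc m) (\<beta> - Suc m)))
        = (of_nat (path_count k n (\<alpha> - m) (\<beta> - m)) :: rat)"
      using assms by (subst path_count_min_eq) simp_all
    then show "fps_nth (path_gf_min m k \<alpha> \<beta>) n = fps_nth (H (\<beta> - m)) n"
      using assms by (auto simp: path_gf_min_def H_def path_gf_def a_def split: if_splits)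
  qed
  \<comment> \<open>At \<open>b = 0\<close> nothing is subtracted in \<open>H\<close>, so
    \<open>H 0\<close> is \<open>path_gf k a 0\<close>.\<close>
  ultimately show ?thesis
    by (simp add: H_def a_def rothe_gf_power[OF k])
qed

end
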